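(* Let $A\in\mathbb{R}_+^{n\times n}$. Then $V^*(A)=\operatorname{span}(S)$, where $$S=\{x^{(\tau,o_\tau)}:\tau\in\mathcal{T}_{ag}(A)\}\cup\{x^{(\tau,k)}:\tau\in\mathcal{C}^{\ge1}(A),\ k\in\operatorname{supp}(\tau)\}.$$
   Context: Max algebra: on $\mathbb{R}_+=[0,\infty)$ use $a\oplus b=\max(a,b)$ and ordinary multiplication; $(A\otimes x)_i=\max_j a_{ij}x_j$; inequalities componentwise. $V^*(A)=\{x\in\mathbb{R}_+^n: A\otimes x\ge x\}$. For $S\subseteq\mathbb{R}_+^n$, $\operatorname{span}(S)$ is the set of all max combinations $\bigoplus_{i=1}^m\lambda_i v^i$, $v^i\in S$, $\lambda_i\in\mathbb{R}_+$. $\mathcal{D}(B)$ is the digraph on $[n]$ with an edge $(i,j)$ of weight $b_{ij}$ whenever $b_{ij}\neq0$; walk weights are products of edge weights; a cycle is a closed walk. A strategy of $\mathcal{D}(A)$ is a map $\tau:\operatorname{supp}(\tau)\to\operatorname{supp}(\tau)$, $\operatorname{supp}(\tau)\subseteq[n]$, with $a_{i,\tau(i)}\neq0$ for $i\in\operatorname{supp}(\tau)$; $\mathcal{D}(A^\tau)$ is the digraph with edges $(i,\tau(i))$, $i\in\operatorname{supp}(\tau)$, of weights $a_{i,\tau(i)}$. Write $k\to_\tau i$ if $k=i$ or there is a walk from $k$ to $i$ in $\mathcal{D}(A^\tau)$, and then let $P^\tau_{ki}$ be the unique such walk not repeating nodes (weight $1$ if $k=i$). Define $x^{(\tau,k)}\in\mathbb{R}_+^n$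 by $x^{(\tau,k)}_k=1$, $x^{(\tau,k)}_i=(w(P^\tau_{ki}))^{-1}$ if $i\ne k$ and $k\to_\tau i$, and $x^{(\tau,k)}_i=0$ otherwise. A cycle of $\mathcal{D}(A)$ with distinct nodes $i_1,\dots,i_p$ (edges $(i_1,i_2),\dots,(i_{p-1},i_p),(i_p,i_1)$) is identified with the strategy $\tau$ with $\operatorname{supp}(\tau)=\{i_1,\dots,i_p\}$, $\tau(i_s)=i_{s+1}$, $\tau(i_p)=i_1$. $\mathcal{C}^{\ge1}(A)$ is the set of such cycles with weight $\ge1$. A strategy $\tau$ is a germ if $\mathcal{D}(A^\tau)$ consists of one cycle and one nonempty walk from a node $o_\tau$ (its origin) to a node of that cycle. The germ is admissible if its cycle has weight $\ge 1$; $\mathcal{T}_{ag}(A)$ is the set of admissible germs. *)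

theory Defs
  imports "HOL-Analysis.Analysis"
begin

definition max_mult :: "real^'n^'n \<Rightarrow> real^'n \<Rightarrow> real^'n" where
  "max_mult A x = (\<chi> i. Max (range (\<lambda>j. A $ i $ j * x $ j)))"

definition V_star :: "real^'n^'n \<Rightarrow> (real^'n) set" where
  "V_star A = {x. 0 \<le> x \<and> x \<le> max_mult A x}"

text \<open>
  The empty combination (\<open>m = 0\<close>) is allowed and equals \<open>0\<close>, the neutral element of the maximum on
  the nonnegative reals; for \<open>m > 0\<close> and nonnegative vectors the inserted \<open>0\<close> has no effect.
\<close>

definition max_comb :: "nat \<Rightarrow> (nat \<Rightarrow> real) \<Rightarrow> (nat \<Rightarrow> real^'n) \<Rightarrow> real^'n" where
  "max_comb m l v = (\<chi> j. Max (insert 0 ((\<lambda>i. l i * v i $ j) ` {..<m})))"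

definition max_span :: "(real^'n) set \<Rightarrow> (real^'n) set" where
  "max_span S = {max_comb m l v | m l v. \<forall>i<m. 0 \<le> l i \<and> v i \<in> S}"

definition edges :: "real^'n^'n \<Rightarrow> ('n \<times> 'n) set" where
  "edges B = {(i, j). B $ i $ j \<noteq> 0}"

text \<open>
  A walk is given by the list of nodes it visits; a one-element list is the empty walk at a node.
\<close>

definition walk_edges :: "'n list \<Rightarrow> ('n \<times> 'n) list" where
  "walk_edges w = zip w (tl w)"

definition walk :: "real^'n^'n \<Rightarrow> 'n list \<Rightarrow> bool" where
  "walk B w \<longleftrightarrow> w \<noteq> [] \<and> set (walk_edges w) \<subseteq> edges B"

definition walk_weight :: "real^'n^'n \<Rightarrow> 'n list \<Rightarrow> real" where
  "walk_weight B w = (\<Prod>(i, j)\<leftarrow>walk_edges w. B $ i $ j)"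

text \<open>
  A cycle with distinct nodes \<open>i\<^sub>1, \<dots>, i\<^sub>p\<close> (\<open>p \<ge> 1\<close>, so loops are included) is given by the list
  \<open>[i\<^sub>1, \<dots>, i\<^sub>p]\<close>; the corresponding closed walk is \<open>[i\<^sub>1, \<dots>, i\<^sub>p, i\<^sub>1]\<close>.
\<close>

definition closed_walk_of :: "'n list \<Rightarrow> 'n list" where
  "closed_walk_of c = c @ [hd c]"

definition simple_cycle :: "real^'n^'n \<Rightarrow> 'n list \<Rightarrow> bool" where
  "simple_cycle B c \<longleftrightarrow> c \<noteq> [] \<and> distinct c \<and> walk B (closed_walk_of c)"

definition cycle_weight :: "real^'n^'n \<Rightarrow> 'n list \<Rightarrow> real" where
  "cycle_weight B c = walk_weight B (closed_walk_of c)"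

text \<open>
  A strategy is a partial map, with support \<open>dom \<tau>\<close>.
\<close>

definition strategy :: "real^'n^'n \<Rightarrow> ('n \<rightharpoonup> 'n) \<Rightarrow> bool" where
  "strategy A \<tau> \<longleftrightarrow> ran \<tau> \<subseteq> dom \<tau> \<and> (\<forall>i j. \<tau> i = Some j \<longrightarrow> A $ i $ j \<noteq> 0)"

definition strategy_matrix :: "real^'n^'n \<Rightarrow> ('n \<rightharpoonup> 'n) \<Rightarrow> real^'n^'n" where
  "strategy_matrix A \<tau> = (\<chi> i j. if \<tau> i = Some j then A $ i $ j else 0)"

definition reaches :: "real^'n^'n \<Rightarrow> ('n \<rightharpoonup> 'n) \<Rightarrow> 'n \<Rightarrow> 'n \<Rightarrow> bool" where
  "reaches A \<tau> k i \<longleftrightarrow> k = i \<or> (\<exists>w. walk (strategy_matrix A \<tau>) w \<and> hd w = k \<and> last w = i)"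

definition strategy_path :: "real^'n^'n \<Rightarrow> ('n \<rightharpoonup> 'n) \<Rightarrow> 'n \<Rightarrow> 'n \<Rightarrow> 'n list" where
  "strategy_path A \<tau> k i =
     (THE w. walk (strategy_matrix A \<tau>) w \<and> hd w = k \<and> last w = i \<and> distinct w)"

definition strategy_vec :: "real^'n^'n \<Rightarrow> ('n \<rightharpoonup> 'n) \<Rightarrow> 'n \<Rightarrow> real^'n" where
  "strategy_vec A \<tau> k = (\<chi> i.
     if i = k then 1
     else if reaches A \<tau> k i
       then inverse (walk_weight (strategy_matrix A \<tau>) (strategy_path A \<tau> k i))
     else 0)"

definition cycle_strategy :: "'n list \<Rightarrow> ('n \<rightharpoonup> 'n)" where
  "cycle_strategy c = map_of (walk_edges (closed_walk_of c))"

definition cycles_ge1 :: "real^'n^'n \<Rightarrow> ('n \<rightharpoonup> 'n) set" where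
  "cycles_ge1 A = {cycle_strategy c | c. simple_cycle A c \<and> 1 \<le> cycle_weight A c}"

text \<open>
  The digraph of \<open>\<tau>\<close> consists of the cycle \<open>c\<close> and the nonempty walk \<open>w\<close>, which meets \<open>c\<close> exactly in
  its final node. In particular the origin \<open>hd w\<close> is not on the cycle, which makes it unique.
\<close>

definition germ_parts :: "real^'n^'n \<Rightarrow> ('n \<rightharpoonup> 'n) \<Rightarrow> 'n list \<Rightarrow> 'n list \<Rightarrow> bool" where
  "germ_parts A \<tau> c w \<longleftrightarrow>
     simple_cycle (strategy_matrix A \<tau>) c \<and>
     walk (strategy_matrix A \<tau>) w \<and> 2 \<le> length w \<and>
     last w \<in> set c \<and> set (butlast w) \<inter> set c = {} \<and>
     edges (strategy_matrix A \<tau>) = set (walk_edges (closed_walk_of c)) \<union> set (walk_edges w)"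

definition germ :: "real^'n^'n \<Rightarrow> ('n \<rightharpoonup> 'n) \<Rightarrow> bool" where
  "germ A \<tau> \<longleftrightarrow> strategy A \<tau> \<and> (\<exists>c w. germ_parts A \<tau> c w)"

definition origin :: "real^'n^'n \<Rightarrow> ('n \<rightharpoonup> 'n) \<Rightarrow> 'n" where
  "origin A \<tau> = (THE k. \<exists>c w. germ_parts A \<tau> c w \<and> hd w = k)"

text \<open>
  The list \<open>c\<close> is determined by the germ up to rotation, so its weight is well defined.
\<close>

definition admissible_germs :: "real^'n^'n \<Rightarrow> ('n \<rightharpoonup> 'n) set" where
  "admissible_germs A = {\<tau>. germ A \<tau> \<and>
     (\<exists>c w. germ_parts A \<tau> c w \<and> 1 \<le> cycle_weight (strategy_matrix A \<tau>) c)}"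

end

theory Submission imports Defs begin

text \<open>
  A generator attached to a strategy is, along the orbit of its starting node, the solution of
  \<open>a\<^bsub>i,\<tau>(i)\<^esub> x\<^bsub>\<tau>(i)\<^esub> = x\<^sub>i\<close>; this equation can only fail where the orbit closes up, and there the left-hand
  side exceeds the right-hand side by the factor given by the weight of the cycle. Hence generators
  lie in \<open>V\<^sup>*(A)\<close>, which is closed under max combinations.

  Conversely, let \<open>x \<in> V\<^sup>*(A)\<close> and \<open>x\<^sub>k > 0\<close>. Choosing for every \<open>i\<close> in the support of \<open>x\<close> some
  \<open>\<sigma>(i)\<close> with \<open>a\<^bsub>i,\<sigma>(i)\<^esub> x\<^bsub>\<sigma>(i)\<^esub> \<ge> x\<^sub>i\<close> and following \<open>\<sigma>\<close> from \<open>k\<close> until a node repeats gives a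
  cycle through \<open>k\<close> or a germ with origin \<open>k\<close>. Multiplying the inequalities along a walk shows that the
  cycle has weight at least 1 and that \<open>x\<^sub>k\<close> times the generator is below \<open>x\<close>, with equality
  at \<open>k\<close>. So \<open>x\<close> is the maximum of these multiples.
\<close>

section \<open>Walks\<close>

lemma walk_edges_simps [simp]:
  "walk_edges [] = []" "walk_edges [x] = []"
  "walk_edges (x # y # w) = (x, y) # walk_edges (y # w)"
  by (simp_all add: walk_edges_def)

lemma walk_edges_append: "walk_edges (u @ j # v) = walk_edges (u @ [j]) @ walk_edges (j # v)"
proof (induction u)
  case (Cons a u)
  then show ?case by (cases u) auto
qed simp

lemma walk_edges_snoc: "u \<noteq> [] \<Longrightarrow> walk_edges (u @ [j]) = walk_edges u @ [(last u, j)]"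
  by (induction u rule: induct_list012) auto

lemma walk_edges_in_set: "(i, j) \<in> set (walk_edges w) \<Longrightarrow> i \<in> set (butlast w) \<and> j \<in> set (tl w)"
  by (induction w rule: induct_list012) (auto split: if_splits)

lemma closed_walk_edge_source: "(i, j) \<in> set (walk_edges (closed_walk_of c)) \<Longrightarrow> i \<in> set c"
  by (drule walk_edges_in_set) (simp add: closed_walk_of_def)

lemma map_fst_walk_edges: "map fst (walk_edges w) = butlast w"
  by (induction w rule: induct_list012) auto

lemma map_snd_walk_edges: "map snd (walk_edges w) = tl w"
  by (induction w rule: induct_list012) auto

lemma walk_append:
  "walk B (u @ j # v) \<longleftrightarrow> walk B (u @ [j]) \<and> walk B (j # v)"
  by (auto simp: walk_def walk_edges_append[of u j v])

lemma walk_snoc: "u \<noteq> [] \<Longrightarrow> walk B (u @ [j]) \<longleftrightarrow> walk B u \<and> (last u, j) \<in> edges B"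
  by (auto simp: walk_def walk_edges_snoc)

lemma walk_Cons: "w \<noteq> [] \<Longrightarrow> walk B (x # w) \<longleftrightarrow> (x, hd w) \<in> edges B \<and> walk B w"
  by (cases w) (auto simp: walk_def)

lemma walk_singleton [simp]: "walk B [x]"
  by (simp add: walk_def)

lemma walk_weight_singleton [simp]: "walk_weight B [x] = 1"
  by (simp add: walk_weight_def)

lemma walk_weight_append:
  "walk_weight B (u @ j # v) = walk_weight B (u @ [j]) * walk_weight B (j # v)"
  by (simp add: walk_weight_def walk_edges_append[of u j v])

lemma walk_weight_snoc: "u \<noteq> [] \<Longrightarrow> walk_weight B (u @ [j]) = walk_weight B u * B $ last u $ j"
  by (simp add: walk_weight_def walk_edges_snoc)

lemma walk_weight_Cons: "w \<noteq> [] \<Longrightarrow> walk_weight B (x # w) = B $ x $ hd w * walk_weight B w"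
  by (cases w) (auto simp: walk_weight_def)

lemma walk_weight_pos:
  assumes "\<And>i j. 0 \<le> B $ i $ j" "walk B w"
  shows "0 < walk_weight B w"
  using assms(2)
proof (induction w rule: induct_list012)
  case (3 x y w)
  then have "B $ x $ y \<noteq> 0" "walk B (y # w)"
    by (auto simp: walk_Cons edges_def)
  with 3 assms(1)[of x y] show ?case
    by (simp add: walk_weight_Cons order.strict_iff_order)
qed (auto simp: walk_def)

text \<open>The inequalities attached to the edges telescope along the walk, nonnegative weights
  preserving their direction. This is the estimate that later bounds both generators and cycle
  weights.\<close>

lemma walk_weight_mult_ge:
  assumes "\<And>i j. 0 \<le> B $ i $ j" "w \<noteq> []"
    and "\<And>i j. (i, j) \<in> set (walk_edges w) \<Longrightarrow> x $ i \<le> B $ i $ j * x $ j"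
  shows "x $ hd w \<le> walk_weight B w * x $ last w"
  using assms(2,3)
proof (induction w rule: induct_list012)
  case (3 a b w)
  have "x $ b \<le> walk_weight B (b # w) * x $ last (b # w)"
    using 3 by auto
  then have "B $ a $ b * x $ b \<le> B $ a $ b * (walk_weight B (b # w) * x $ last (b # w))"
    by (intro mult_left_mono assms)
  moreover have "x $ a \<le> B $ a $ b * x $ b"
    using 3 by auto
  ultimately show ?case
    by (simp add: walk_weight_Cons mult.assoc)
qed auto

text \<open>The tail is shortened first. If the new head already occurs on the shortened tail,
  everything before that occurrence is cut off.\<close>

lemma distinct_walk_exists:
  "walk B w \<Longrightarrow> \<exists>w'. walk B w' \<and> hd w' = hd w \<and> last w' = last w \<and> distinct w'"
proof (induction w rule: induct_list012)
  case (2 x)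
  then show ?case by (intro exI[of _ "[x]"]) simp
next
  case (3 x y w)
  then obtain w' where w': "walk B w'" "hd w' = y" "last w' = last (y # w)" "distinct w'"
    by (auto simp: walk_Cons)
  then have ne: "w' \<noteq> []" by (auto simp: walk_def)
  show ?case
  proof (cases "x \<in> set w'")
    case True
    then obtain u v where "w' = u @ x # v" by (meson split_list)
    then show ?thesis using w' by (intro exI[of _ "x # v"]) (auto simp: walk_append[of B u x v])
  next
    case False
    then show ?thesis using w' 3 ne by (intro exI[of _ "x # w'"]) (auto simp: walk_Cons)
  qed
qed (auto simp: walk_def)

text \<open>A set closed under successors traps every walk that enters it. It is applied with
  \<open>S\<close> the node set of a cycle of a strategy, where out-degrees are at most one.\<close>

lemma walk_into_closed:
  assumes "walk B w" "\<And>i j. i \<in> S \<Longrightarrow> (i, j) \<in> edges B \<Longrightarrow> j \<in> S" "i \<in> set w" "i \<in> S"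
  shows "last w \<in> S"
  using assms(1,3,4)
proof (induction w arbitrary: i rule: induct_list012)
  case (3 x y w)
  show ?case
  proof (cases "i = x")
    case True
    then have "y \<in> S" using 3 assms(2) by (auto simp: walk_Cons)
    then show ?thesis using "3.IH"(2)[of y] "3.prems" by (simp add: walk_Cons)
  next
    case False
    then show ?thesis using "3.IH"(2)[of i] "3.prems" by (simp add: walk_Cons)
  qed
qed auto

lemma walk_within_closed:
  assumes "walk B w" "\<And>i j. i \<in> S \<Longrightarrow> (i, j) \<in> edges B \<Longrightarrow> j \<in> S" "hd w \<in> S"
  shows "set w \<subseteq> S"
  using assms(1,3)
proof (induction w rule: induct_list012)
  case (3 x y w)
  then show ?case using assms(2) by (auto simp: walk_Cons)
qed auto

section \<open>Digraphs of strategies\<close>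

lemma edges_strategy_matrix:
  assumes "strategy A \<tau>"
  shows "(i, j) \<in> edges (strategy_matrix A \<tau>) \<longleftrightarrow> \<tau> i = Some j"
  using assms by (auto simp: edges_def strategy_matrix_def strategy_def)

text \<open>Each node has at most one successor, so the two walks run in step; distinctness forces
  both to stop at their first visit to the common final node.\<close>

lemma distinct_strategy_walk_unique:
  assumes "strategy A \<tau>"
    and "walk (strategy_matrix A \<tau>) w" "walk (strategy_matrix A \<tau>) w'"
    and "distinct w" "distinct w'" "hd w = hd w'" "last w = last w'"
  shows "w = w'"
  using assms(2-)
proof (induction w arbitrary: w' rule: induct_list012)
  case (2 x)
  then show ?case by (cases w') (auto simp: walk_def split: if_splits)
next
  case (3 x y w)
  then obtain v where v: "w' = x # v" by (cases w') (auto simp: walk_def)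
  with 3 have ne: "v \<noteq> []" by (auto split: if_splits)
  with 3 v have "hd v = y"
    by (auto simp: walk_Cons edges_strategy_matrix[OF assms(1)])
  with 3 v ne show ?case by (auto simp: walk_Cons)
qed (auto simp: walk_def)

lemma strategy_path_eq:
  assumes "strategy A \<tau>" "walk (strategy_matrix A \<tau>) w" "distinct w"
  shows "strategy_path A \<tau> (hd w) (last w) = w"
  unfolding strategy_path_def
  by (rule the_equality) (use assms distinct_strategy_walk_unique in auto)

text \<open>Merges two cases of the definition of \<open>strategy_vec\<close>: the entry 1 at
  \<open>k\<close> is the inverse weight of the one-node walk. Afterwards any distinct walk can be
  used in place of the definite description.\<close>

lemma strategy_vec_walk:
  assumes "strategy A \<tau>" "walk (strategy_matrix A \<tau>) w" "distinct w"
  shows "strategy_vec A \<tau> (hd w) $ last w = inverse (walk_weight (strategy_matrix A \<tau>) w)"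
proof (cases "last w = hd w")
  case True
  then have "w = [hd w]"
    using assms by (cases w) (auto simp: walk_def split: if_splits)
  then have "walk_weight (strategy_matrix A \<tau>) w = 1"
    using walk_weight_singleton by metis
  with True show ?thesis by (simp add: strategy_vec_def)
next
  case False
  then show ?thesis
    using assms by (auto simp: strategy_vec_def reaches_def strategy_path_eq)
qed

lemma strategy_vec_cases:
  assumes "strategy A \<tau>" "strategy_vec A \<tau> k $ i \<noteq> 0"
  obtains w where "walk (strategy_matrix A \<tau>) w" "distinct w" "hd w = k" "last w = i"
proof -
  have "reaches A \<tau> k i"
    using assms by (auto simp: strategy_vec_def reaches_def split: if_splits)
  then have "\<exists>w. walk (strategy_matrix A \<tau>) w \<and> hd w = k \<and> last w = i"
    unfolding reaches_def by (metis walk_singleton list.sel(1) last.simps)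
  then show thesis
    using distinct_walk_exists that by metis
qed

lemma strategy_vec_self [simp]: "strategy_vec A \<tau> k $ k = 1"
  by (simp add: strategy_vec_def)

section \<open>Generators belong to the cone\<close>

lemma strategy_matrix_nonneg:
  assumes "\<And>i j. 0 \<le> A $ i $ j"
  shows "0 \<le> strategy_matrix A \<tau> $ i $ j"
  using assms by (simp add: strategy_matrix_def)

lemma strategy_vec_nonneg:
  assumes "\<And>i j. 0 \<le> A $ i $ j" "strategy A \<tau>"
  shows "0 \<le> strategy_vec A \<tau> k $ i"
proof (cases "strategy_vec A \<tau> k $ i = 0")
  case False
  with assms obtain w
    where w: "walk (strategy_matrix A \<tau>) w" "distinct w" "hd w = k" "last w = i"
    using strategy_vec_cases by metis
  then have "0 < walk_weight (strategy_matrix A \<tau>) w"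
    by (intro walk_weight_pos strategy_matrix_nonneg assms)
  then show ?thesis
    using strategy_vec_walk[OF assms(2) w(1,2)] w by simp
qed simp

lemma max_mult_ge: "A $ i $ j * x $ j \<le> max_mult A x $ i"
  by (auto simp: max_mult_def intro: Max_ge)

text \<open>Assuming the bound for every simple cycle of the strategy lets germs and cycles share
  one proof. At a node \<open>i\<close> with nonzero entry, the successor
  \<open>j = \<tau> i\<close> witnesses the required inequality.\<close>

lemma strategy_vec_in_V_star:
  assumes nonneg: "\<And>i j. 0 \<le> A $ i $ j" and "strategy A \<tau>" "k \<in> dom \<tau>"
    and cyc: "\<And>c. simple_cycle (strategy_matrix A \<tau>) c \<Longrightarrow> 1 \<le> cycle_weight (strategy_matrix A \<tau>) c"
  shows "strategy_vec A \<tau> k \<in> V_star A"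
proof -
  let ?B = "strategy_matrix A \<tau>" and ?x = "strategy_vec A \<tau> k"
  note edges_iff = edges_strategy_matrix[OF assms(2)]
  have "?x $ i \<le> max_mult A ?x $ i" for i
  proof (cases "?x $ i = 0")
    case True
    have "0 \<le> A $ i $ k * ?x $ k" using nonneg by simp
    also have "\<dots> \<le> max_mult A ?x $ i" by (rule max_mult_ge)
    finally show ?thesis using True by simp
  next
    case False
    with assms obtain w where w: "walk ?B w" "distinct w" "hd w = k" "last w = i"
      using strategy_vec_cases by metis
    have xi: "?x $ i = inverse (walk_weight ?B w)"
      using strategy_vec_walk[OF assms(2) w(1,2)] w by simp
    have w_ne: "w \<noteq> []" using w by (auto simp: walk_def)
    \<comment> \<open>The range of a strategy lies in its domain, so membership in the domain
      propagates from \<open>k\<close> along \<open>w\<close>.\<close>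
    have "i \<in> dom \<tau>"
    proof -
      have "set w \<subseteq> dom \<tau>"
        by (rule walk_within_closed[OF w(1)])
          (use assms w in \<open>auto simp: edges_iff strategy_def ran_def\<close>)
      then show ?thesis using w w_ne last_in_set by blast
    qed
    then obtain j where j: "\<tau> i = Some j" by auto
    then have Bij: "?B $ i $ j = A $ i $ j" and edge: "(i, j) \<in> edges ?B"
      by (simp add: strategy_matrix_def, simp add: edges_iff)
    have snoc: "walk ?B (w @ [j])" "walk_weight ?B (w @ [j]) = walk_weight ?B w * A $ i $ j"
      using w w_ne edge Bij by (simp_all add: walk_snoc walk_weight_snoc)
    have pos: "0 < walk_weight ?B v" if "walk ?B v" for v
      using that by (intro walk_weight_pos strategy_matrix_nonneg nonneg)
    have "?x $ i \<le> A $ i $ j * ?x $ j"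
    proof (cases "j \<in> set w")
      \<comment> \<open>A fresh node merely extends the path, so here the inequality is an
        equality.\<close>
      case False
      have "?x $ j = inverse (walk_weight ?B (w @ [j]))"
        using strategy_vec_walk[OF assms(2) snoc(1)] w False w_ne by simp
      moreover have "A $ i $ j \<noteq> 0" using pos[OF snoc(1)] snoc(2) by auto
      ultimately show ?thesis by (simp add: snoc(2) xi field_simps)
    next
      case True
      \<comment> \<open>The orbit closes up at \<open>j\<close>. The quotient of
        \<open>A $ i $ j * ?x $ j\<close> by \<open>?x $ i\<close> is then the weight of the cycle
        \<open>j # v\<close>, which is at least 1.\<close>
      then obtain u v where uv: "w = u @ j # v" by (meson split_list)
      have walks: "walk ?B (u @ [j])" "walk ?B (j # v)" "walk ?B (closed_walk_of (j # v))"
        using snoc(1) w(1) walk_append[of ?B u j "v @ [j]"] walk_append[of ?B u j v]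
        by (auto simp: uv closed_walk_of_def)
      have "simple_cycle ?B (j # v)"
        using walks w by (auto simp: simple_cycle_def uv)
      then have ge1: "1 \<le> walk_weight ?B (j # v) * A $ i $ j"
        using cyc[of "j # v"] w walk_weight_snoc[of "j # v" ?B j] Bij
        by (auto simp: cycle_weight_def closed_walk_of_def uv)
      have "hd (u @ [j]) = k"
        using w uv by (cases u) auto
      then have xj: "?x $ j = inverse (walk_weight ?B (u @ [j]))"
        using strategy_vec_walk[OF assms(2) walks(1)] w uv by auto
      have weight_w: "walk_weight ?B w = walk_weight ?B (u @ [j]) * walk_weight ?B (j # v)"
        by (simp add: uv walk_weight_append[of ?B u j v])
      show ?thesis
        unfolding xi xj weight_w using ge1 pos[OF walks(1)] pos[OF walks(2)]
        by (simp add: field_simps)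
    qed
    also have "\<dots> \<le> max_mult A ?x $ i" by (rule max_mult_ge)
    finally show ?thesis .
  qed
  then show ?thesis
    using strategy_vec_nonneg[OF nonneg assms(2)] by (auto simp: V_star_def less_eq_vec_def)
qed

section \<open>Max combinations and closure of the cone under them\<close>

lemma max_comb_ge: "i < m \<Longrightarrow> l i * v i $ j \<le> max_comb m l v $ j"
  by (auto simp: max_comb_def intro!: Max_ge)

lemma max_comb_nonneg: "0 \<le> max_comb m l v $ j"
  by (auto simp: max_comb_def intro!: Max_ge)

lemma max_comb_cases:
  obtains "max_comb m l v $ j = 0" | i where "i < m" "max_comb m l v $ j = l i * v i $ j"
proof -
  have "max_comb m l v $ j \<in> insert 0 ((\<lambda>i. l i * v i $ j) ` {..<m})"
    unfolding max_comb_def by (simp only: vec_lambda_beta) (rule Max_in, auto)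
  then show thesis using that by auto
qed

lemma max_mult_attained: "\<exists>j. max_mult A x $ i = A $ i $ j * x $ j"
proof -
  have "max_mult A x $ i \<in> range (\<lambda>j. A $ i $ j * x $ j)"
    unfolding max_mult_def by (simp only: vec_lambda_beta) (rule Max_in, auto)
  then show ?thesis by auto
qed

text \<open>A nonzero coordinate of the combination comes from a single summand \<open>v r\<close>.
  The index attaining the maximum for \<open>v r\<close> there also serves the combination, which
  dominates \<open>l r\<close> times \<open>v r\<close>.\<close>

lemma max_span_subset_V_star:
  assumes nonneg: "\<And>i j. 0 \<le> A $ i $ j" and "S \<subseteq> V_star A"
  shows "max_span S \<subseteq> V_star A"
proof
  fix x assume "x \<in> max_span S"
  then obtain m l v where x: "x = max_comb m l v"
    and lv: "\<And>i. i < m \<Longrightarrow> 0 \<le> l i" "\<And>i. i < m \<Longrightarrow> v i \<in> V_star A"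
    using assms(2) unfolding max_span_def by blast
  have "x $ i \<le> max_mult A x $ i" for i
  proof (cases rule: max_comb_cases[of m l v i])
    case 1
    have "0 \<le> A $ i $ i * x $ i" using nonneg by (simp add: x max_comb_nonneg)
    then show ?thesis using max_mult_ge[of A i i x] 1 by (simp add: x)
  next
    case (2 r)
    obtain j where "max_mult A (v r) $ i = A $ i $ j * v r $ j"
      using max_mult_attained by metis
    then have "v r $ i \<le> A $ i $ j * v r $ j"
      using lv(2)[OF 2(1)] by (auto simp: V_star_def less_eq_vec_def dest: spec[of _ i])
    then have "l r * v r $ i \<le> l r * (A $ i $ j * v r $ j)"
      using lv 2 by (intro mult_left_mono) auto
    also have "\<dots> = A $ i $ j * (l r * v r $ j)" by simp
    also have "\<dots> \<le> A $ i $ j * x $ j"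
      unfolding x by (intro mult_left_mono max_comb_ge nonneg 2)
    also have "\<dots> \<le> max_mult A x $ i" by (rule max_mult_ge)
    finally show ?thesis using 2 by (simp add: x)
  qed
  then show "x \<in> V_star A"
    by (simp add: V_star_def less_eq_vec_def x max_comb_nonneg)
qed

section \<open>Cycles of germs\<close>

text \<open>Every node of \<open>c\<close> is the source of an edge of the closed walk, and a
  strategy offers no second edge out of it.\<close>

lemma simple_cycle_closed:
  assumes "strategy A \<tau>" "simple_cycle (strategy_matrix A \<tau>) c"
    and "i \<in> set c" "(i, j) \<in> edges (strategy_matrix A \<tau>)"
  shows "j \<in> set c"
proof -
  let ?e = "walk_edges (closed_walk_of c)"
  have "i \<in> set (map fst ?e)"
    using assms by (simp only: map_fst_walk_edges) (simp add: closed_walk_of_def)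
  then obtain j' where e: "(i, j') \<in> set ?e" by auto
  then have "(i, j') \<in> edges (strategy_matrix A \<tau>)"
    using assms by (auto simp: simple_cycle_def walk_def)
  then have "j' = j" using assms by (simp add: edges_strategy_matrix)
  moreover have "j' \<in> set c"
    using walk_edges_in_set[OF e] assms(2)
    by (cases c) (auto simp: closed_walk_of_def simple_cycle_def)
  ultimately show ?thesis by simp
qed

lemma simple_cycle_subset:
  assumes "strategy A \<tau>" "simple_cycle (strategy_matrix A \<tau>) c" "simple_cycle (strategy_matrix A \<tau>) c'"
    and "set c \<inter> set c' \<noteq> {}"
  shows "set c' \<subseteq> set c"
proof -
  let ?w = "closed_walk_of c'"
  have w: "walk (strategy_matrix A \<tau>) ?w" "last ?w = hd ?w" "set c' \<subseteq> set ?w"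
    using assms by (auto simp: simple_cycle_def closed_walk_of_def)
  obtain i where "i \<in> set c" "i \<in> set ?w" using assms w by blast
  \<comment> \<open>Once the closed walk enters \<open>c\<close> it ends in \<open>c\<close>; its
    end is also its start, so it lies in \<open>c\<close> throughout.\<close>
  then have "last ?w \<in> set c"
    using walk_into_closed[OF w(1)] simple_cycle_closed[OF assms(1,2)] by blast
  then have "set ?w \<subseteq> set c"
    using walk_within_closed[OF w(1)] simple_cycle_closed[OF assms(1,2)] w(2) by metis
  with w show ?thesis by blast
qed

text \<open>Expressing the weight through the node set makes it independent of the rotation of the
  list, so cycles with the same nodes have equal weights.\<close>

lemma cycle_weight_prod:
  assumes "strategy A \<tau>" "simple_cycle (strategy_matrix A \<tau>) c"
  shows "cycle_weight (strategy_matrix A \<tau>) c = (\<Prod>i\<in>set c. A $ i $ the (\<tau> i))"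
proof -
  let ?e = "walk_edges (closed_walk_of c)"
  have "\<tau> i = Some j" if "(i, j) \<in> set ?e" for i j
    using that assms by (auto simp: simple_cycle_def walk_def edges_strategy_matrix)
  then have "cycle_weight (strategy_matrix A \<tau>) c = prod_list (map (\<lambda>e. A $ fst e $ the (\<tau> (fst e))) ?e)"
    unfolding cycle_weight_def walk_weight_def
    by (intro arg_cong[of _ _ prod_list] map_cong) (auto simp: strategy_matrix_def)
  also have "\<dots> = prod_list (map (\<lambda>i. A $ i $ the (\<tau> i)) (map fst ?e))"
    by (simp add: o_def)
  also have "map fst ?e = c"
    by (simp only: map_fst_walk_edges) (simp add: closed_walk_of_def)
  finally show ?thesis
    using assms(2) by (simp add: simple_cycle_def prod.distinct_set_conv_list)
qed

lemma cycle_weight_eq: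
  assumes "strategy A \<tau>" "simple_cycle (strategy_matrix A \<tau>) c" "simple_cycle (strategy_matrix A \<tau>) c'"
    and "set c \<inter> set c' \<noteq> {}"
  shows "cycle_weight (strategy_matrix A \<tau>) c' = cycle_weight (strategy_matrix A \<tau>) c"
proof -
  have "set c' = set c"
    using simple_cycle_subset[OF assms] simple_cycle_subset[OF assms(1,3,2)] assms(4) by blast
  then show ?thesis using assms by (simp add: cycle_weight_prod)
qed

section \<open>Decompositions of a germ: its cycle and its origin\<close>

lemma simple_cycle_hd_edge:
  assumes "simple_cycle B c"
  obtains j where "(hd c, j) \<in> edges B"
proof -
  have "walk B (hd c # (tl c @ [hd c]))"
    using assms by (cases c) (auto simp: simple_cycle_def closed_walk_of_def)
  then show thesis using that by (auto simp: walk_Cons)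
qed

text \<open>The head of \<open>c'\<close> has an outgoing edge, so it lies on \<open>c\<close> or on
  \<open>w\<close>. In the latter case \<open>w\<close> is trapped in \<open>c'\<close> and its
  final node, which is on \<open>c\<close>, is shared.\<close>

lemma germ_cycles_meet:
  assumes "strategy A \<tau>" "germ_parts A \<tau> c w" "simple_cycle (strategy_matrix A \<tau>) c'"
  shows "set c \<inter> set c' \<noteq> {}"
proof -
  obtain j where "(hd c', j) \<in> edges (strategy_matrix A \<tau>)"
    using simple_cycle_hd_edge[OF assms(3)] .
  then have "(hd c', j) \<in> set (walk_edges (closed_walk_of c)) \<or> (hd c', j) \<in> set (walk_edges w)"
    using assms(2) by (auto simp: germ_parts_def)
  then have "hd c' \<in> set c \<or> hd c' \<in> set w"
    by (auto dest: closed_walk_edge_source walk_edges_in_set in_set_butlastD)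
  moreover have hd: "hd c' \<in> set c'" using assms(3) by (auto simp: simple_cycle_def)
  moreover have "last w \<in> set c'" if "hd c' \<in> set w"
    using walk_into_closed[of "strategy_matrix A \<tau>" w "set c'" "hd c'"] that hd assms
      simple_cycle_closed[OF assms(1,3)] by (auto simp: germ_parts_def)
  ultimately show ?thesis using assms(2) by (auto simp: germ_parts_def)
qed

text \<open>\<open>germ_parts\<close> does not state that \<open>w\<close> is distinct. Together
  with the disjointness from \<open>c\<close>, this lemma shows that no edge enters the
  origin.\<close>

lemma germ_hd_notin_tl:
  assumes "strategy A \<tau>" "germ_parts A \<tau> c w"
  shows "hd w \<notin> set (tl w)"
proof
  let ?B = "strategy_matrix A \<tau>"
  assume *: "hd w \<in> set (tl w)"
  obtain h t where ht: "w = h # t" using assms(2) by (cases w) (auto simp: germ_parts_def)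
  with * obtain u v where "t = u @ h # v" by (auto dest: split_list)
  with ht have w: "w = (h # u) @ h # v" by simp
  have part: "walk ?B w" "last w \<in> set c" "set (butlast w) \<inter> set c = {}"
    using assms(2) by (auto simp: germ_parts_def)
  have ne: "v \<noteq> []" using part(2,3) w by auto
  have "walk ?B (closed_walk_of (h # u))"
    using part(1) walk_append[of ?B "h # u" h v] w by (simp add: closed_walk_of_def)
  txt \<open>A closed walk at the origin would trap \<open>w\<close> away from \<open>c\<close>.\<close>
  have "last w \<in> set (h # u)"
  proof (rule walk_into_closed[OF part(1)])
    fix i j assume i: "i \<in> set (h # u)" and ij: "(i, j) \<in> edges ?B"
    let ?e = "walk_edges (closed_walk_of (h # u))"
    have "i \<in> set (map fst ?e)"
      using i by (simp only: map_fst_walk_edges) (simp add: closed_walk_of_def)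
    then obtain j' where e: "(i, j') \<in> set ?e" by auto
    then have "(i, j') \<in> edges ?B"
      using \<open>walk ?B (closed_walk_of (h # u))\<close> by (auto simp: walk_def)
    then have "j' = j" using ij assms(1) by (simp add: edges_strategy_matrix)
    then show "j \<in> set (h # u)"
      using walk_edges_in_set[OF e] by (auto simp: closed_walk_of_def)
  next
    show "h \<in> set w" "h \<in> set (h # u)" using w by auto
  qed
  moreover have "set (h # u) \<subseteq> set (butlast w)" using w ne by (auto simp: butlast_append)
  ultimately show False using part by blast
qed

text \<open>The origin is recognised in the digraph itself: it has an outgoing edge but no incoming
  one. If the origins differed, the first decomposition would give \<open>hd w'\<close> an incoming
  edge, which the second excludes.\<close>

lemma germ_origin_unique:
  assumes "strategy A \<tau>" "germ_parts A \<tau> c w" "germ_parts A \<tau> c' w'"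
  shows "hd w = hd w'"
proof (rule ccontr)
  let ?B = "strategy_matrix A \<tau>"
  assume ne: "hd w \<noteq> hd w'"
  have len: "2 \<le> length w" "2 \<le> length w'"
    and E: "edges ?B = set (walk_edges (closed_walk_of c)) \<union> set (walk_edges w)"
    and E': "edges ?B = set (walk_edges (closed_walk_of c')) \<union> set (walk_edges w')"
    and c': "set (butlast w') \<inter> set c' = {}" and c: "c \<noteq> []"
    and c'_ne: "c' \<noteq> []"
    using assms by (auto simp: germ_parts_def simple_cycle_def)
  have "walk ?B w'" using assms by (simp add: germ_parts_def)
  then have "(hd w', hd (tl w')) \<in> edges ?B"
    using len(2) by (cases w'; cases "tl w'") (auto simp: walk_Cons)
  then have "hd w' \<in> set c \<or> hd w' \<in> set w"
    unfolding E by (auto dest: closed_walk_edge_source walk_edges_in_set in_set_butlastD)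
  \<comment> \<open>Dropping the first entry of a closed walk loses no node, since that node recurs
    at the end; dropping the first entry of \<open>w\<close> loses at most
    \<open>hd w\<close>.\<close>
  then have "hd w' \<in> set (tl (closed_walk_of c)) \<or> hd w' \<in> set (tl w)"
    using ne c len(1) by (cases c; cases w) (auto simp: closed_walk_of_def)
  then have "hd w' \<in> snd ` edges ?B"
    unfolding E image_Un set_map[symmetric] map_snd_walk_edges by auto
  then have "hd w' \<in> set (tl (closed_walk_of c')) \<or> hd w' \<in> set (tl w')"
    unfolding E' image_Un set_map[symmetric] map_snd_walk_edges by auto
  moreover have "hd w' \<notin> set (tl w')"
    using germ_hd_notin_tl assms by blast
  moreover have "hd w' \<notin> set c'"
    using c' len(2) by (cases w'; cases "tl w'") auto
  ultimately show False using c'_ne by (cases c') (auto simp: closed_walk_of_def)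
qed

lemma origin_eq:
  assumes "strategy A \<tau>" "germ_parts A \<tau> c w"
  shows "origin A \<tau> = hd w"
  unfolding origin_def by (rule the_equality) (use assms germ_origin_unique in blast)+

lemma germ_vec_in_V_star:
  assumes "\<And>i j. 0 \<le> A $ i $ j" "\<tau> \<in> admissible_germs A"
  shows "strategy_vec A \<tau> (origin A \<tau>) \<in> V_star A"
proof -
  let ?B = "strategy_matrix A \<tau>"
  obtain c w where \<tau>: "strategy A \<tau>" and parts: "germ_parts A \<tau> c w" and c: "1 \<le> cycle_weight ?B c"
    using assms(2) by (auto simp: admissible_germs_def germ_def)
  have "walk ?B w" "2 \<le> length w" using parts by (auto simp: germ_parts_def)
  then have "(hd w, hd (tl w)) \<in> edges ?B"
    by (cases w; cases "tl w") (auto simp: walk_Cons)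
  then have "origin A \<tau> \<in> dom \<tau>"
    using \<tau> parts by (auto simp: origin_eq edges_strategy_matrix)
  moreover have "1 \<le> cycle_weight ?B c'" if "simple_cycle ?B c'" for c'
    using cycle_weight_eq[OF \<tau> _ that germ_cycles_meet[OF \<tau> parts that]] c parts
    by (auto simp: germ_parts_def)
  ultimately show ?thesis by (intro strategy_vec_in_V_star assms \<tau>)
qed

section \<open>Strategies read off a walk\<close>

lemma map_of_walk_edges:
  assumes "distinct (butlast w)"
  shows "map_of (walk_edges w) i = Some j \<longleftrightarrow> (i, j) \<in> set (walk_edges w)"
  using assms by (simp add: map_fst_walk_edges)

text \<open>Distinct sources make the edge list a partial function. The repeated final node puts
  every target back among the sources, so the range lies in the domain.\<close>

lemma strategy_map_of_walk_edges:
  assumes "walk A w" "distinct (butlast w)" "last w \<in> set (butlast w)"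
  shows "strategy A (map_of (walk_edges w))"
proof -
  have "dom (map_of (walk_edges w)) = set (butlast w)"
    by (simp only: dom_map_of_conv_image_fst set_map[symmetric] map_fst_walk_edges)
  moreover have "set w \<subseteq> set (butlast w)"
    using assms(1,3) by (cases w rule: rev_cases) (auto simp: walk_def)
  moreover have "j \<in> set w" if "(i, j) \<in> set (walk_edges w)" for i j
    using walk_edges_in_set[OF that] by (cases w) auto
  ultimately show ?thesis
    using assms unfolding strategy_def ran_def
    by (auto simp del: map_of_eq_Some_iff simp: map_of_walk_edges walk_def edges_def)
qed

lemma edges_map_of_walk_edges:
  assumes "walk A w" "distinct (butlast w)" "last w \<in> set (butlast w)"
  shows "edges (strategy_matrix A (map_of (walk_edges w))) = set (walk_edges w)"
  using edges_strategy_matrix[OF strategy_map_of_walk_edges[OF assms]] map_of_walk_edges[OF assms(2)]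
  by auto

lemma walk_weight_strategy_matrix:
  assumes "strategy A \<tau>" "walk (strategy_matrix A \<tau>) w"
  shows "walk_weight (strategy_matrix A \<tau>) w = walk_weight A w"
  unfolding walk_weight_def
proof (intro arg_cong[of _ _ prod_list] map_cong)
  fix e assume "e \<in> set (walk_edges w)"
  then have "e \<in> edges (strategy_matrix A \<tau>)" using assms(2) by (auto simp: walk_def)
  then show "(case e of (i, j) \<Rightarrow> strategy_matrix A \<tau> $ i $ j) = (case e of (i, j) \<Rightarrow> A $ i $ j)"
    by (auto simp: edges_def strategy_matrix_def split: if_splits)
qed simp

lemma cycle_strategy_props:
  assumes "simple_cycle A c"
  shows "strategy A (cycle_strategy c)"
    and "edges (strategy_matrix A (cycle_strategy c)) = set (walk_edges (closed_walk_of c))"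
    and "simple_cycle (strategy_matrix A (cycle_strategy c)) c"
    and "cycle_weight (strategy_matrix A (cycle_strategy c)) c = cycle_weight A c"
proof -
  have w: "walk A (closed_walk_of c)" "distinct (butlast (closed_walk_of c))"
    "last (closed_walk_of c) \<in> set (butlast (closed_walk_of c))"
    using assms by (auto simp: simple_cycle_def closed_walk_of_def)
  show \<tau>: "strategy A (cycle_strategy c)"
    and E: "edges (strategy_matrix A (cycle_strategy c)) = set (walk_edges (closed_walk_of c))"
    unfolding cycle_strategy_def
    by (rule strategy_map_of_walk_edges[OF w], rule edges_map_of_walk_edges[OF w])
  show C: "simple_cycle (strategy_matrix A (cycle_strategy c)) c"
    using assms E by (auto simp: simple_cycle_def walk_def)
  show "cycle_weight (strategy_matrix A (cycle_strategy c)) c = cycle_weight A c"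
    using walk_weight_strategy_matrix[OF \<tau>] C by (simp add: cycle_weight_def simple_cycle_def)
qed

text \<open>All edges of the strategy start on \<open>c\<close>, so any simple cycle in its digraph
  meets \<open>c\<close> and has the same weight.\<close>

lemma cycle_vec_in_V_star:
  assumes "\<And>i j. 0 \<le> A $ i $ j" "\<tau> \<in> cycles_ge1 A" "k \<in> dom \<tau>"
  shows "strategy_vec A \<tau> k \<in> V_star A"
proof -
  obtain c where c: "\<tau> = cycle_strategy c" "simple_cycle A c" "1 \<le> cycle_weight A c"
    using assms(2) by (auto simp: cycles_ge1_def)
  note props = cycle_strategy_props[OF c(2), folded c(1)]
  have "1 \<le> cycle_weight (strategy_matrix A \<tau>) c'" if c': "simple_cycle (strategy_matrix A \<tau>) c'" for c'
  proof -
    obtain j where "(hd c', j) \<in> edges (strategy_matrix A \<tau>)"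
      using simple_cycle_hd_edge[OF c'] .
    then have "hd c' \<in> set c"
      by (auto simp: props dest: closed_walk_edge_source)
    moreover have "hd c' \<in> set c'" using c' by (auto simp: simple_cycle_def)
    ultimately have "set c \<inter> set c' \<noteq> {}" by blast
    then show ?thesis
      using cycle_weight_eq[OF props(1,3) c'] c(3) props(4) by simp
  qed
  then show ?thesis by (intro strategy_vec_in_V_star assms props)
qed

section \<open>Generators below a given vector\<close>

text \<open>A longest repetition-free orbit segment from \<open>k\<close> exists by finiteness. Its
  next node must repeat, splitting it into a stem \<open>u\<close> and a cycle
  \<open>v\<close>.\<close>

lemma orbit_closes_up:
  fixes k :: "'n::finite"
  obtains u v where "distinct (u @ v)" "v \<noteq> []" "hd (u @ v) = k"
    "\<And>i j. (i, j) \<in> set (walk_edges (u @ v @ [hd v])) \<Longrightarrow> j = \<sigma> i"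
proof -
  let ?P = "\<lambda>w. w \<noteq> [] \<and> distinct w \<and> hd w = k \<and> (\<forall>(i, j)\<in>set (walk_edges w). j = \<sigma> i)"
  have bound: "\<forall>w. ?P w \<longrightarrow> length w < Suc CARD('n)"
    by (metis card_mono distinct_card finite less_Suc_eq_le subset_UNIV)
  have "?P [k]" by simp
  then obtain w where w: "?P w" and max: "\<forall>w'. ?P w' \<longrightarrow> length w' \<le> length w"
    using ex_has_greatest_nat[of ?P "[k]" length "Suc CARD('n)"] bound by auto
  have "\<not> ?P (w @ [\<sigma> (last w)])" using max by (metis length_append_singleton not_less_eq_eq order_refl)
  then have "\<sigma> (last w) \<in> set w" using w by (auto simp: walk_edges_snoc)
  then obtain u v where uv: "w = u @ \<sigma> (last w) # v" by (meson split_list)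
  show thesis
  proof (rule that[of u "\<sigma> (last w) # v"])
    fix i j assume "(i, j) \<in> set (walk_edges (u @ (\<sigma> (last w) # v) @ [hd (\<sigma> (last w) # v)]))"
    then have "(i, j) \<in> set (walk_edges (w @ [\<sigma> (last w)]))"
      by (metis append_assoc list.sel(1) uv)
    then show "j = \<sigma> i" using w by (auto simp: walk_edges_snoc)
  qed (use w uv in auto)
qed

lemma generator_below:
  fixes A :: "real^'n^'n"
  assumes nonneg: "\<And>i j. 0 \<le> A $ i $ j" and "x \<in> V_star A" "0 < x $ k"
  obtains \<tau> where "\<And>i. x $ k * strategy_vec A \<tau> k $ i \<le> x $ i"
    "\<tau> \<in> admissible_germs A \<and> origin A \<tau> = k \<or> \<tau> \<in> cycles_ge1 A \<and> k \<in> dom \<tau>"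
proof -
  have "\<exists>j. x $ i \<le> A $ i $ j * x $ j" for i
    using assms(2) max_mult_attained[of A x i] by (fastforce simp: V_star_def less_eq_vec_def dest: spec[of _ i])
  \<comment> \<open>For each \<open>i\<close>, \<open>\<sigma> i\<close> can be an index attaining
    the maximum in \<open>max_mult A x $ i\<close>; choosing it for all \<open>i\<close> makes
    \<open>\<sigma>\<close> total.\<close>
  then obtain \<sigma> where \<sigma>: "\<And>i. x $ i \<le> A $ i $ \<sigma> i * x $ \<sigma> i" by metis
  have x0: "0 \<le> x $ i" for i
    using assms(2) by (auto simp: V_star_def less_eq_vec_def)
  have next_pos: "0 < x $ \<sigma> i \<and> A $ i $ \<sigma> i \<noteq> 0" if "0 < x $ i" for i
    using \<sigma>[of i] x0[of "\<sigma> i"] that by (cases "x $ \<sigma> i = 0"; cases "A $ i $ \<sigma> i = 0") auto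
  obtain u v where uv: "distinct (u @ v)" "v \<noteq> []" "hd (u @ v) = k"
    and next_eq: "\<And>i j. (i, j) \<in> set (walk_edges (u @ v @ [hd v])) \<Longrightarrow> j = \<sigma> i"
    using orbit_closes_up[of k \<sigma>] by metis
  define w where "w = u @ v @ [hd v]"
  have w_eq: "w = u @ hd v # tl v @ [hd v]" using uv(2) by (simp add: w_def)
  have hd_w: "hd w = k" using uv(2,3) by (auto simp: w_def hd_append)
  \<comment> \<open>Both claims go in one induction: a positive entry at a node yields the nonzero
    edge weight and the positive entry at its successor.\<close>
  have w_pos: "(\<forall>i\<in>set w. 0 < x $ i) \<and> walk A w"
  proof -
    have "(\<forall>i\<in>set p. 0 < x $ i) \<and> walk A p"
      if "p \<noteq> []" "0 < x $ hd p" "\<And>i j. (i, j) \<in> set (walk_edges p) \<Longrightarrow> j = \<sigma> i" for p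
      using that
    proof (induction p rule: induct_list012)
      case (3 a b p)
      have "b = \<sigma> a" using 3(5) by simp
      moreover have "0 < x $ a" using 3(4) by simp
      ultimately have "0 < x $ b" "A $ a $ b \<noteq> 0" using next_pos[of a] by auto
      with 3 show ?case by (auto simp: walk_Cons edges_def)
    qed auto
    moreover have "w \<noteq> []" by (simp add: w_eq)
    moreover have "0 < x $ hd w" by (simp add: hd_w assms(3))
    ultimately show ?thesis using next_eq unfolding w_def[symmetric] by blast
  qed
  have w: "walk A w" "distinct (butlast w)" "last w \<in> set (butlast w)"
    using w_pos uv by (auto simp: w_def butlast_append)
  define \<tau> where "\<tau> = map_of (walk_edges w)"
  let ?B = "strategy_matrix A \<tau>"
  have \<tau>: "strategy A \<tau>" and E: "edges ?B = set (walk_edges w)"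
    unfolding \<tau>_def by (rule strategy_map_of_walk_edges[OF w], rule edges_map_of_walk_edges[OF w])
  \<comment> \<open>Used twice: on paths from \<open>k\<close> it bounds the generator, and on the
    closed walk of \<open>v\<close> cancelling \<open>x $ hd v\<close> bounds the cycle weight below
    by 1.\<close>
  have B_ge: "x $ hd p \<le> walk_weight ?B p * x $ last p" if "walk ?B p" for p
  proof (rule walk_weight_mult_ge)
    fix i j assume "(i, j) \<in> set (walk_edges p)"
    then have ij: "(i, j) \<in> edges ?B" using that by (auto simp: walk_def)
    then have "j = \<sigma> i" using E next_eq by (simp add: w_def)
    moreover have "?B $ i $ j = A $ i $ j"
      using ij by (auto simp: edges_def strategy_matrix_def split: if_splits)
    ultimately show "x $ i \<le> ?B $ i $ j * x $ j" using \<sigma> by simp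
  qed (use that nonneg in \<open>auto simp: walk_def strategy_matrix_nonneg\<close>)
  have below: "x $ k * strategy_vec A \<tau> k $ i \<le> x $ i" for i
  proof (cases "strategy_vec A \<tau> k $ i = 0")
    case True
    then show ?thesis using x0 by simp
  next
    case False
    then obtain p where p: "walk ?B p" "distinct p" "hd p = k" "last p = i"
      using strategy_vec_cases[OF \<tau>] by metis
    have "0 < walk_weight ?B p"
      by (intro walk_weight_pos strategy_matrix_nonneg nonneg p)
    then have "x $ k * inverse (walk_weight ?B p) \<le> x $ i"
      using B_ge[OF p(1)] p by (simp add: field_simps)
    then show ?thesis
      using strategy_vec_walk[OF \<tau> p(1,2)] p by simp
  qed
  have walk_w: "walk ?B w" using E w by (simp add: walk_def)
  have closed_v: "closed_walk_of v = hd v # tl v @ [hd v]"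
    using uv(2) by (simp add: closed_walk_of_def)
  have cyc: "simple_cycle ?B v"
    using walk_w uv walk_append[of ?B u "hd v" "tl v @ [hd v]"]
    by (auto simp: simple_cycle_def closed_v w_eq)
  have cyc_ge1: "1 \<le> cycle_weight ?B v"
  proof -
    have "0 < x $ hd v" using w_pos by (simp add: w_def)
    then show ?thesis
      using B_ge[of "closed_walk_of v"] cyc
      by (auto simp: simple_cycle_def cycle_weight_def closed_v)
  qed
  have cycle: "\<tau> \<in> cycles_ge1 A \<and> k \<in> dom \<tau>" if "u = []"
  proof -
    have \<tau>_eq: "\<tau> = cycle_strategy v"
      using that by (simp add: \<tau>_def w_def cycle_strategy_def closed_walk_of_def)
    have "simple_cycle A v"
      using w that uv by (auto simp: simple_cycle_def w_def closed_walk_of_def)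
    moreover have "cycle_weight A v = cycle_weight ?B v"
      using cycle_strategy_props(4)[OF \<open>simple_cycle A v\<close>] by (simp add: \<tau>_eq)
    moreover have "dom \<tau> = set (butlast w)"
      unfolding \<tau>_def by (simp only: dom_map_of_conv_image_fst set_map[symmetric] map_fst_walk_edges)
    then have "k \<in> dom \<tau>" using that uv by (auto simp: w_def)
    ultimately show ?thesis
      using cyc_ge1 \<tau>_eq by (auto simp: cycles_ge1_def)
  qed
  have germ: "\<tau> \<in> admissible_germs A \<and> origin A \<tau> = k" if "u \<noteq> []"
  proof -
    \<comment> \<open>With a nonempty stem, the walk part is the stem followed by its entry point
      \<open>hd v\<close> into the cycle.\<close>
    have "germ_parts A \<tau> v (u @ [hd v])"
      unfolding germ_parts_def
    proof (intro conjI cyc)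
      show "walk ?B (u @ [hd v])"
        using walk_w walk_append[of ?B u "hd v" "tl v @ [hd v]"] by (simp add: w_eq)
      show "2 \<le> length (u @ [hd v])" using that by (cases u) auto
      show "edges ?B = set (walk_edges (closed_walk_of v)) \<union> set (walk_edges (u @ [hd v]))"
        using walk_edges_append[of u "hd v" "tl v @ [hd v]"] by (auto simp: E w_eq closed_v)
    qed (use uv in auto)
    moreover have "hd (u @ [hd v]) = k" using that uv by simp
    ultimately show ?thesis
      using origin_eq[OF \<tau>] \<tau> cyc_ge1
      by (auto simp: admissible_germs_def germ_def)
  qed
  show thesis
    by (rule that[OF below]) (cases "u = []"; simp only: cycle germ simp_thms)
qed

text \<open>One multiple per positive coordinate suffices: each stays below \<open>x\<close> and
  touches it at its own coordinate. For \<open>x = 0\<close> this is the empty combination.\<close>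

lemma in_max_span_if_touching:
  fixes x :: "real^'n"
  assumes "0 \<le> x"
    and "\<And>k. 0 < x $ k \<Longrightarrow> \<exists>g\<in>S. g $ k = 1 \<and> (\<forall>i. x $ k * g $ i \<le> x $ i)"
  shows "x \<in> max_span S"
proof -
  have "\<forall>k\<in>{k. 0 < x $ k}. \<exists>g. g \<in> S \<and> g $ k = 1 \<and> (\<forall>i. x $ k * g $ i \<le> x $ i)"
    using assms(2) by blast
  from bchoice[OF this] obtain g
    where g: "\<And>k. 0 < x $ k \<Longrightarrow> g k \<in> S \<and> g k $ k = 1 \<and> (\<forall>i. x $ k * g k $ i \<le> x $ i)"
    by blast
  obtain ks where ks: "set ks = {k. 0 < x $ k}"
    using finite_list[of "{k. 0 < x $ k}"] by auto
  define l where "l r = x $ (ks ! r)" for r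
  define v where "v r = g (ks ! r)" for r
  have pos: "0 < x $ (ks ! r)" if "r < length ks" for r
    using nth_mem[OF that] ks by simp
  have "max_comb (length ks) l v $ i = x $ i" for i
  proof (rule antisym)
    show "max_comb (length ks) l v $ i \<le> x $ i"
    proof (cases rule: max_comb_cases[of "length ks" l v i])
      case 1
      then show ?thesis using assms(1) by (simp add: less_eq_vec_def)
    next
      case (2 r)
      then show ?thesis using g[OF pos] by (simp add: l_def v_def)
    qed
    show "x $ i \<le> max_comb (length ks) l v $ i"
    proof (cases "0 < x $ i")
      case True
      then obtain r where r: "r < length ks" "ks ! r = i"
        using ks by (metis in_set_conv_nth mem_Collect_eq)
      then show ?thesis
        using max_comb_ge[OF r(1), of l v i] g[OF True] by (simp add: l_def v_def)
    next
      case False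
      then show ?thesis using max_comb_nonneg[of "length ks" l v i] by linarith
    qed
  qed
  then have "x = max_comb (length ks) l v" by (simp add: vec_eq_iff)
  moreover have "\<forall>r<length ks. 0 \<le> l r \<and> v r \<in> S"
    using g[OF pos] pos by (auto simp: l_def v_def less_imp_le)
  ultimately show ?thesis unfolding max_span_def by blast
qed

theorem theorem2p5:
  fixes A :: "real^'n^'n"
  assumes "\<And>i j. 0 \<le> A $ i $ j"
  shows "V_star A = max_span
    ({strategy_vec A \<tau> (origin A \<tau>) | \<tau>. \<tau> \<in> admissible_germs A} \<union>
     {strategy_vec A \<tau> k | \<tau> k. \<tau> \<in> cycles_ge1 A \<and> k \<in> dom \<tau>})"
    (is "_ = max_span ?S")
proof
  show "max_span ?S \<subseteq> V_star A"
    using germ_vec_in_V_star[OF assms] cycle_vec_in_V_star[OF assms]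
    by (intro max_span_subset_V_star assms) auto
  show "V_star A \<subseteq> max_span ?S"
  proof
    fix x assume x: "x \<in> V_star A"
    show "x \<in> max_span ?S"
    proof (rule in_max_span_if_touching)
      show "0 \<le> x" using x by (simp add: V_star_def)
      fix k assume "0 < x $ k"
      with assms x obtain \<tau> where \<tau>: "\<And>i. x $ k * strategy_vec A \<tau> k $ i \<le> x $ i"
        "\<tau> \<in> admissible_germs A \<and> origin A \<tau> = k \<or> \<tau> \<in> cycles_ge1 A \<and> k \<in> dom \<tau>"
        using generator_below by metis
      then show "\<exists>g\<in>?S. g $ k = 1 \<and> (\<forall>i. x $ k * g $ i \<le> x $ i)"
        by (intro bexI[of _ "strategy_vec A \<tau> k"]) (simp, blast)
    qed
  qed
qed

end
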